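(* Let $K'/K$ be a finite separable extension of function fields of degree $n$, with a fixed $K$-basis of $K'$. Let $g$ be a matrix pair over $K$. Then $$\mathrm{CoN}(\mathrm{LP}(g))=\mathrm{LP}(\mathrm{CoN}(g)).$$ Let $g'$ be a matrix pair over $K'$. Then $$\mathrm{Rest}(\mathrm{LP}(g'))=\mathrm{LP}(\mathrm{Rest}(g')).$$
   Context: Setting. $k$ is a perfect field, $K$ a finite separable extension of $k(x)$, $K'/K$ finite separable of degree $n$. $k(x)_\infty$ is the valuation ring of $-\deg$ in $k(x)$. $A_{fi},A_\infty$ (resp. $A'_{fi},A'_\infty$) are the integral closures of $k[x]$ and $k(x)_\infty$ in $K$ (resp. in $K'$). A $K$-basis $c_1,\dots,c_n$ of $K'$ is fixed; it identifies $K'$ with $K^n$ and $K'^r$ with $K^{rn}$ via the basis $(e_1c_1,e_1c_2,\dots,e_1c_n,e_2c_1,\dots,e_rc_n)$, where $(e_i)$ is the canonical basis of $K'^r$. Lattice pairs. For a Dedekind domain $A$ with fraction field $F$, an $A$-lattice of rank $r$ is a finitely generated (projective) $A$-submodule of $F^r$ spanning $F^r$. A lattice pair of rank $r$ over $K$ is a pair $L=(L_{fi},L_\infty)$ of an $A_{fi}$-lattice and an $A_\infty$-lattice, both in $K^r$; similarly over $K'$ with $A'_{fi},A'_\infty$. A matrix pair of rank $r$ over $K$ is $g=(\mathfrak a,g_{fi},g_\infty)$ with $\mathfrak a=(\mathfrak a_1,\dots,\mathfrak a_r)$ fractional ideals of $A_{fi}$ and $g_{fi},g_\infty\in GL_r(K)$;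 its lattice pair is $\mathrm{LP}(g)=\left(\bigoplus_i\mathfrak a_ix_i,\ g_\infty A_\infty^r\right)$ where $x_i$ are the columns of $g_{fi}$. Same definitions over $K'$. Restriction and conorm of lattice pairs. For $L'=(L'_{fi},L'_\infty)$ a lattice pair of rank $r$ over $K'$, $\mathrm{Rest}(L')$ is the lattice pair of rank $rn$ over $K$ consisting of $L'_{fi}$ and $L'_\infty$ seen as an $A_{fi}$- and an $A_\infty$-lattice under $K'^r=K^{rn}$. For $L$ a lattice pair of rank $r$ over $K$, $\mathrm{CoN}(L)=(A'_{fi}L_{fi},A'_\infty L_\infty)$, a lattice pair in $K'^r$. Restriction and conorm of matrix pairs. For $g=(\mathfrak a,g_{fi},g_\infty)$ over $K$, $\mathrm{CoN}(g)=\left((\mathfrak a_1A'_{fi},\dots,\mathfrak a_rA'_{fi}),g_{fi},g_\infty\right)$. Let $*\in\{fi,\infty\}$, and let $(\mathfrak a,g)$ consist of fractional ideals $\mathfrak a_1,\dots,\mathfrak a_r$ of $A'_*$ and a matrix $g\in GL_r(K')$. For each $i$ choose a pseudo-basis of $\mathfrak a_i$ over $A_*$: fractional ideals $\mathfrak b_{i1},\dots,\mathfrak b_{in}$ of $A_*$ and $a_{i1},\dots,a_{in}\in K'$ with $\mathfrak a_i=\bigoplus_j\mathfrak b_{ij}a_{ij}$. Then $\mathrm{Rest}(\mathfrak a,g)$ has coefficient ideals $(\mathfrak b_{11},\mathfrak b_{12},\dots,\mathfrak b_{1n},\mathfrak b_{21},\dots,\mathfrak b_{rn})$ and the $rn\times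 rn$ matrix over $K$ whose column indexed by $(i,j)$ (lexicographic order) is the vector $(a_{ij}g_{1i},a_{ij}g_{2i},\dots,a_{ij}g_{ri})$, each entry $a_{ij}g_{\ell i}\in K'$ being written as a column vector in $K^n$. For $*=\infty$ all coefficient ideals are trivial: one takes $\mathfrak a_i=A'_\infty$ with an $A_\infty$-basis $(a_{ij})_j$ and $\mathfrak b_{ij}=A_\infty$, so only a matrix results. For a matrix pair $g'=(\mathfrak a',g'_{fi},g'_\infty)$ over $K'$, $\mathrm{Rest}(g')=(\mathfrak a,g_{fi},g_\infty)$ with $(\mathfrak a,g_{fi})=\mathrm{Rest}(\mathfrak a',g'_{fi})$ and $g_\infty=\mathrm{Rest}(g'_\infty)$. *)

theory Defs
  imports "HOL-Computational_Algebra.Computational_Algebra" "Jordan_Normal_Form.Matrix"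
begin

section \<open>Field extensions\<close>

text \<open>A polynomial over a field is separable if it has no repeated root in an algebraic closure;
  in terms of the polynomial alone, it is coprime to its derivative.\<close>
definition separable_poly :: "'a::field poly \<Rightarrow> bool" where
  "separable_poly p \<longleftrightarrow> coprime p (pderiv p)"

definition perfect_field :: "'k::field itself \<Rightarrow> bool" where
  "perfect_field _ \<longleftrightarrow> (\<forall>p::'k poly. irreducible p \<longrightarrow> separable_poly p)"

text \<open>A field extension is given by a homomorphism \<open>f\<close> of fields, which makes the target a vector
  space over the source. An irreducible polynomial vanishing at \<open>\<alpha>\<close> is, up to a constant factor,
  the minimal polynomial of \<open>\<alpha>\<close>.\<close>
abbreviation scale_by :: "('a::field \<Rightarrow> 'b::field) \<Rightarrow> 'a \<Rightarrow> 'b \<Rightarrow> 'b" where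
  "scale_by f \<equiv> (\<lambda>a x. f a * x)"

definition finite_separable :: "('a::field \<Rightarrow> 'b::field) \<Rightarrow> bool" where
  "finite_separable f \<longleftrightarrow>
     field_hom f \<and>
     (\<exists>B. finite_dimensional_vector_space (scale_by f) B) \<and>
     (\<forall>\<alpha>. \<exists>p. irreducible p \<and> separable_poly p \<and> poly (map_poly f p) \<alpha> = 0)"

definition field_basis :: "('a::field \<Rightarrow> 'b::field) \<Rightarrow> 'b list \<Rightarrow> bool" where
  "field_basis f c \<longleftrightarrow> distinct c \<and> finite_dimensional_vector_space (scale_by f) (set c)"


section \<open>The rings of a function field\<close>

text \<open>The field \<open>k(x)\<close> is \<^typ>\<open>'k poly fract\<close>.\<close>

definition poly_subring :: "'k::field poly fract set" where
  "poly_subring = range to_fract"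

text \<open>The elements of \<open>k(x)\<close> with \<open>-deg \<ge> 0\<close>. As \<^term>\<open>degree 0 = 0\<close>, zero is included.\<close>
definition infinite_valuation_ring :: "'k::field poly fract set" where
  "infinite_valuation_ring = {Fract p q |p q. q \<noteq> 0 \<and> degree p \<le> degree q}"

definition integral_closure :: "'a::field set \<Rightarrow> 'a set" where
  "integral_closure R = {\<alpha>. \<exists>p. lead_coeff p = 1 \<and> set (coeffs p) \<subseteq> R \<and> poly p \<alpha> = 0}"

definition ring_fi :: "('k::field poly fract \<Rightarrow> 'a::field) \<Rightarrow> 'a set" where
  "ring_fi \<phi> = integral_closure (\<phi> ` poly_subring)"

definition ring_inf :: "('k::field poly fract \<Rightarrow> 'a::field) \<Rightarrow> 'a set" where
  "ring_inf \<phi> = integral_closure (\<phi> ` infinite_valuation_ring)"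

definition fractional_ideal :: "'a::field set \<Rightarrow> 'a set \<Rightarrow> bool" where
  "fractional_ideal A I \<longleftrightarrow>
     0 \<in> I \<and> (\<forall>x\<in>I. \<forall>y\<in>I. x + y \<in> I) \<and> (\<forall>a\<in>A. \<forall>x\<in>I. a * x \<in> I) \<and>
     I \<noteq> {0} \<and> (\<exists>d\<in>A. d \<noteq> 0 \<and> (\<forall>x\<in>I. d * x \<in> A))"


section \<open>Lattice pairs and matrix pairs\<close>

text \<open>A lattice pair is represented by its two underlying sets of vectors, and the operations on
  lattice pairs below are defined for arbitrary pairs of sets of vectors. A matrix pair consists of
  its coefficient ideals, its finite matrix and its infinite matrix.\<close>
type_synonym 'a lattice_pair = "'a vec set \<times> 'a vec set"
type_synonym 'a matrix_pair = "'a set list \<times> 'a mat \<times> 'a mat"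

definition GL :: "nat \<Rightarrow> 'a::field mat set" where
  "GL r = {g \<in> carrier_mat r r. invertible_mat g}"

definition is_matrix_pair :: "'a::field set \<Rightarrow> nat \<Rightarrow> 'a matrix_pair \<Rightarrow> bool" where
  "is_matrix_pair A_fi r = (\<lambda>(I, g_fi, g_inf).
     length I = r \<and> (\<forall>i<r. fractional_ideal A_fi (I ! i)) \<and> g_fi \<in> GL r \<and> g_inf \<in> GL r)"

text \<open>The sum of the \<open>I\<^sub>i x\<^sub>i\<close>, where \<open>x\<^sub>i\<close> are the columns of \<open>g\<close>: the product of \<open>g\<close> with a vector
  \<open>y\<close> is the sum of the \<open>y\<^sub>i x\<^sub>i\<close>. For invertible \<open>g\<close> the sum is direct.\<close>
definition ideal_sum :: "'a::field set list \<Rightarrow> 'a mat \<Rightarrow> 'a vec set" where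
  "ideal_sum I g =
     {g *\<^sub>v y |y. y \<in> carrier_vec (length I) \<and> (\<forall>i<length I. y $ i \<in> I ! i)}"

definition LP :: "'a::field set \<Rightarrow> 'a matrix_pair \<Rightarrow> 'a lattice_pair" where
  "LP A_inf = (\<lambda>(I, g_fi, g_inf).
     (ideal_sum I g_fi, ideal_sum (replicate (length I) A_inf) g_inf))"


section \<open>Conorm\<close>

text \<open>The \<open>A'\<close>-submodule of the target generated by (the image under \<open>\<psi>\<close> of) an ideal \<open>I\<close>,
  respectively a set \<open>L\<close> of vectors of length \<open>r\<close>: all finite sums of products.\<close>
definition extend_ideal :: "('a::field \<Rightarrow> 'b::field) \<Rightarrow> 'b set \<Rightarrow> 'a set \<Rightarrow> 'b set" where
  "extend_ideal \<psi> A' I =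
     {\<Sum>j<m. a j * \<psi> (s j) |(m::nat) a s. \<forall>j<m. a j \<in> A' \<and> s j \<in> I}"

definition extend_lattice ::
  "('a::field \<Rightarrow> 'b::field) \<Rightarrow> 'b set \<Rightarrow> nat \<Rightarrow> 'a vec set \<Rightarrow> 'b vec set" where
  "extend_lattice \<psi> A' r L =
     {vec r (\<lambda>l. \<Sum>j<m. a j * \<psi> (s j $ l)) |(m::nat) a s. \<forall>j<m. a j \<in> A' \<and> s j \<in> L}"

definition CoN_lattice_pair ::
  "('a::field \<Rightarrow> 'b::field) \<Rightarrow> 'b set \<Rightarrow> 'b set \<Rightarrow> nat \<Rightarrow> 'a lattice_pair \<Rightarrow> 'b lattice_pair" where
  "CoN_lattice_pair \<psi> A'_fi A'_inf r = (\<lambda>(L_fi, L_inf).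
     (extend_lattice \<psi> A'_fi r L_fi, extend_lattice \<psi> A'_inf r L_inf))"

definition CoN_matrix_pair ::
  "('a::field \<Rightarrow> 'b::field) \<Rightarrow> 'b set \<Rightarrow> 'a matrix_pair \<Rightarrow> 'b matrix_pair" where
  "CoN_matrix_pair \<psi> A'_fi = (\<lambda>(I, g_fi, g_inf).
     (map (extend_ideal \<psi> A'_fi) I, map_mat \<psi> g_fi, map_mat \<psi> g_inf))"


section \<open>Restriction\<close>

text \<open>The identification of \<open>K'\<^sup>r\<close> with \<open>K\<^sup>r\<^sup>n\<close> by the basis \<open>e\<^sub>1c\<^sub>1, \<dots>, e\<^sub>1c\<^sub>n, e\<^sub>2c\<^sub>1, \<dots>, e\<^sub>rc\<^sub>n\<close>.
  Indices start at 0, so the coordinate for \<open>e\<^sub>lc\<^sub>m\<close> has index \<open>l * n + m\<close>.\<close>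
definition restrict_vec :: "('a::field \<Rightarrow> 'b::field) \<Rightarrow> 'b list \<Rightarrow> 'b vec \<Rightarrow> 'a vec" where
  "restrict_vec \<psi> c v = vec (dim_vec v * length c)
     (\<lambda>i. module.representation (scale_by \<psi>) (set c)
            (v $ (i div length c)) (c ! (i mod length c)))"

definition Rest_lattice_pair ::
  "('a::field \<Rightarrow> 'b::field) \<Rightarrow> 'b list \<Rightarrow> 'b lattice_pair \<Rightarrow> 'a lattice_pair" where
  "Rest_lattice_pair \<psi> c = (\<lambda>(L_fi, L_inf). (restrict_vec \<psi> c ` L_fi, restrict_vec \<psi> c ` L_inf))"

text \<open>Bijectivity of the map from the product of the \<open>b\<^sub>j\<close> says that \<open>I\<close> is the direct sum of the
  \<open>b\<^sub>ja\<^sub>j\<close>, respectively that the \<open>a\<^sub>j\<close> form an \<open>A\<close>-basis of \<open>M\<close>.\<close>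
definition is_pseudo_basis :: "('a::field \<Rightarrow> 'b::field) \<Rightarrow> 'a set \<Rightarrow> nat \<Rightarrow>
    'b set \<Rightarrow> (nat \<Rightarrow> 'a set) \<Rightarrow> (nat \<Rightarrow> 'b) \<Rightarrow> bool" where
  "is_pseudo_basis \<psi> A n I b a \<longleftrightarrow>
     (\<forall>j<n. fractional_ideal A (b j)) \<and>
     bij_betw (\<lambda>y. \<Sum>j<n. \<psi> (y j) * a j) (\<Pi>\<^sub>E j\<in>{..<n}. b j) I"

definition is_module_basis :: "('a::field \<Rightarrow> 'b::field) \<Rightarrow> 'a set \<Rightarrow> nat \<Rightarrow>
    'b set \<Rightarrow> (nat \<Rightarrow> 'b) \<Rightarrow> bool" where
  "is_module_basis \<psi> A n M a \<longleftrightarrow>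
     bij_betw (\<lambda>y. \<Sum>j<n. \<psi> (y j) * a j) ({..<n} \<rightarrow>\<^sub>E A) M"

definition Rest_ideals :: "nat \<Rightarrow> nat \<Rightarrow> (nat \<Rightarrow> nat \<Rightarrow> 'a set) \<Rightarrow> 'a set list" where
  "Rest_ideals r n b = [b i j. i \<leftarrow> [0..<r], j \<leftarrow> [0..<n]]"

definition Rest_matrix :: "('a::field \<Rightarrow> 'b::field) \<Rightarrow> 'b list \<Rightarrow> nat \<Rightarrow>
    (nat \<Rightarrow> nat \<Rightarrow> 'b) \<Rightarrow> 'b mat \<Rightarrow> 'a mat" where
  "Rest_matrix \<psi> c r a g = mat_of_cols (r * length c)
     [restrict_vec \<psi> c (a i j \<cdot>\<^sub>v col g i). i \<leftarrow> [0..<r], j \<leftarrow> [0..<length c]]"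

text \<open>The restriction of a matrix pair depends on the chosen bases, which are arguments here:
  pseudo-bases \<open>b i\<close>, \<open>a i\<close> of the coefficient ideals over the finite ring, and bases \<open>d i\<close> of the
  upper infinite ring over the lower one (one for each \<open>i\<close>).\<close>
definition Rest_matrix_pair :: "('a::field \<Rightarrow> 'b::field) \<Rightarrow> 'b list \<Rightarrow>
    (nat \<Rightarrow> nat \<Rightarrow> 'a set) \<Rightarrow> (nat \<Rightarrow> nat \<Rightarrow> 'b) \<Rightarrow> (nat \<Rightarrow> nat \<Rightarrow> 'b) \<Rightarrow>
    'b matrix_pair \<Rightarrow> 'a matrix_pair" where
  "Rest_matrix_pair \<psi> c b a d = (\<lambda>(I, g_fi, g_inf).
     (Rest_ideals (length I) (length c) b,
      Rest_matrix \<psi> c (length I) a g_fi,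
      Rest_matrix \<psi> c (length I) d g_inf))"

end

theory Submission
  imports Defs "Jordan_Normal_Form.Char_Poly"
begin

text \<open>Multiplying a matrix \<open>g\<close> with coefficient vectors turns both claims into statements about
  coefficients.

  For the conorm, an element of the module generated by the image of \<open>ideal_sum I g\<close> is
  \<open>\<Sum>\<^sub>j a\<^sub>j \<psi>(g y\<^sub>j) = \<psi>(g) (\<Sum>\<^sub>j a\<^sub>j \<psi>(y\<^sub>j))\<close> with the \<open>i\<close>-th coordinates of the \<open>y\<^sub>j\<close> in \<open>I\<^sub>i\<close>, and
  the coefficient vectors \<open>\<Sum>\<^sub>j a\<^sub>j \<psi>(y\<^sub>j)\<close> that occur are exactly those with \<open>i\<close>-th entry in the
  extended ideal of \<open>I\<^sub>i\<close> (\<open>extend_lattice_ideal_sum\<close>). At the finite places this is the claim. At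
  infinity it leaves the equality of the upper infinite ring with the ideal that the lower one
  generates in it. This holds because the lower ring contains 1, and the upper ring contains the
  image of the lower one and is closed under sums and products. The last of these is the only point that needs algebra: the integral
  closure of a subring of a field is a subring (\<open>subring_set_integral_closure\<close>), proved by
  realising differences and products of integral elements as eigenvalues of matrices over the subring.

  For the restriction, expanding each coefficient \<open>y\<^sub>i\<close> as \<open>\<Sum>\<^sub>j \<psi>(z\<^sub>i\<^sub>j) a\<^sub>i\<^sub>j\<close> gives
  \<open>g y = \<Sum>\<^sub>i\<^sub>j \<psi>(z\<^sub>i\<^sub>j) (a\<^sub>i\<^sub>j x\<^sub>i)\<close>, with \<open>x\<^sub>i\<close> the columns of \<open>g\<close>. As taking coordinates is linear over the lower
  field, the restriction of \<open>g y\<close> is the restricted matrix times the vector of all \<open>z\<^sub>i\<^sub>j\<close>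
  (\<open>restrict_vec_mult_mat_vec\<close>), and the \<open>z\<^sub>i\<^sub>j\<close> range over the coefficient ideals of the
  restriction.\<close>

\<comment> \<open>The symbol is needed for vector entries, and without type annotations both readings can be type-correct.\<close>
no_notation fps_nth (infixl \<open>$\<close> 75)

section \<open>The integral closure of a subring is a subring\<close>

text \<open>A subset of a commutative ring that is a subring with the same unit. Closure under differences
  covers zero, sums and negatives.\<close>
locale subring_set =
  fixes R :: "'a::comm_ring_1 set"
  assumes one_mem: "1 \<in> R"
    and diff_mem: "\<And>x y. x \<in> R \<Longrightarrow> y \<in> R \<Longrightarrow> x - y \<in> R"
    and mult_mem: "\<And>x y. x \<in> R \<Longrightarrow> y \<in> R \<Longrightarrow> x * y \<in> R"
begin

lemma zero_mem: "0 \<in> R"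
  using diff_mem[OF one_mem one_mem] by simp

lemma uminus_mem: "x \<in> R \<Longrightarrow> - x \<in> R"
  using diff_mem[OF zero_mem, of x] by simp

lemma add_mem: "x \<in> R \<Longrightarrow> y \<in> R \<Longrightarrow> x + y \<in> R"
  using diff_mem[of x "- y"] uminus_mem[of y] by simp

lemma sum_mem: "(\<And>i. i \<in> T \<Longrightarrow> f i \<in> R) \<Longrightarrow> sum f T \<in> R"
  by (induction T rule: infinite_finite_induct) (auto intro: zero_mem add_mem)

lemma prod_mem: "(\<And>i. i \<in> T \<Longrightarrow> f i \<in> R) \<Longrightarrow> prod f T \<in> R"
  by (induction T rule: infinite_finite_induct) (auto intro: one_mem mult_mem)

lemma coeffs_subset_iff: "set (coeffs p) \<subseteq> R \<longleftrightarrow> (\<forall>i. coeff p i \<in> R)"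
  using range_coeff[of p] zero_mem by (metis UNIV_I image_subset_iff insert_subset)

lemma subring_set_polys: "subring_set {p. \<forall>i. coeff p i \<in> R}"
proof
  show "1 \<in> {p. \<forall>i. coeff p i \<in> R}"
    by (auto simp: coeff_1 one_mem zero_mem)
next
  fix p q :: "'a poly"
  assume p: "p \<in> {p. \<forall>i. coeff p i \<in> R}" and q: "q \<in> {p. \<forall>i. coeff p i \<in> R}"
  show "p - q \<in> {p. \<forall>i. coeff p i \<in> R}"
    using p q by (auto intro: diff_mem)
  show "p * q \<in> {p. \<forall>i. coeff p i \<in> R}"
    using p q by (auto simp: coeff_mult intro!: sum_mem mult_mem)
qed

lemma det_mem:
  assumes "A \<in> carrier_mat n n" and "\<And>i j. i < n \<Longrightarrow> j < n \<Longrightarrow> A $$ (i, j) \<in> R"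
  shows "det A \<in> R"
  unfolding det_def'[OF assms(1)]
proof (intro sum_mem mult_mem prod_mem)
  fix p assume "p \<in> {p. p permutes {0..<n}}"
  then have p: "p permutes {0..<n}" by simp
  show "signof p \<in> R"
    by (auto simp: sign_def intro: one_mem uminus_mem)
  fix i assume "i \<in> {0..<n}"
  with permutes_in_image[OF p, of i] show "A $$ (i, p i) \<in> R"
    by (intro assms(2)) auto
qed

lemma coeff_char_poly_mem:
  assumes A: "A \<in> carrier_mat n n" and mem: "\<And>i j. i < n \<Longrightarrow> j < n \<Longrightarrow> A $$ (i, j) \<in> R"
  shows "coeff (char_poly A) k \<in> R"
proof -
  have "char_poly A \<in> {p. \<forall>i. coeff p i \<in> R}"
    unfolding char_poly_def
  proof (rule subring_set.det_mem[OF subring_set_polys])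
    show "char_poly_matrix A \<in> carrier_mat n n" using A by simp
    fix i j assume "i < n" "j < n"
    then show "char_poly_matrix A $$ (i, j) \<in> {p. \<forall>i. coeff p i \<in> R}"
      using A mem[of i j]
      by (auto simp: char_poly_matrix_def coeff_pCons split: nat.split
          intro: one_mem zero_mem uminus_mem add_mem)
  qed
  then show ?thesis by simp
qed

end

lemma (in field_hom) subring_set_image:
  assumes "subring_set R"
  shows "subring_set (hom ` R)"
proof -
  interpret subring_set R by fact
  show ?thesis
  proof
    show "1 \<in> hom ` R" using one_mem hom_one by (metis imageI)
  next
    fix x y assume "x \<in> hom ` R" "y \<in> hom ` R"
    then obtain u v where "u \<in> R" "x = hom u" "v \<in> R" "y = hom v" by auto
    then show "x - y \<in> hom ` R" "x * y \<in> hom ` R"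
      by (auto simp flip: hom_minus hom_mult intro!: imageI diff_mem mult_mem)
  qed
qed

text \<open>The submodule over \<open>R\<close> that a set \<open>S\<close> of ring elements generates; used for finite \<open>S\<close> only,
  so that each element of \<open>S\<close> can be given its own coefficient.\<close>
definition ring_span :: "'a::comm_ring_1 set \<Rightarrow> 'a set \<Rightarrow> 'a set" where
  "ring_span R S = {\<Sum>s\<in>S. u s * s |u. \<forall>s\<in>S. u s \<in> R}"

context subring_set
begin

lemma ring_span_base:
  assumes "finite S" "s \<in> S"
  shows "s \<in> ring_span R S"
proof -
  have "(\<Sum>t\<in>S. (if t = s then 1 else 0) * t) = s"
    using assms by (simp add: if_distrib[of "\<lambda>x. x * _"] cong: if_cong)
  then show ?thesis
    unfolding ring_span_def
    by (intro CollectI exI[of _ "\<lambda>t. if t = s then 1 else 0"]) (auto simp: one_mem zero_mem)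
qed

lemma ring_span_zero: "0 \<in> ring_span R S"
  unfolding ring_span_def by (intro CollectI exI[of _ "\<lambda>_. 0"]) (auto simp: zero_mem)

lemma ring_span_diff:
  assumes "x \<in> ring_span R S" "y \<in> ring_span R S"
  shows "x - y \<in> ring_span R S"
proof -
  obtain u v where "x = (\<Sum>s\<in>S. u s * s)" "\<forall>s\<in>S. u s \<in> R"
    "y = (\<Sum>s\<in>S. v s * s)" "\<forall>s\<in>S. v s \<in> R"
    using assms by (auto simp: ring_span_def)
  then show ?thesis
    unfolding ring_span_def
    by (intro CollectI exI[of _ "\<lambda>s. u s - v s"])
      (auto simp: sum_subtractf left_diff_distrib intro: diff_mem)
qed

lemma ring_span_add:
  assumes "x \<in> ring_span R S" "y \<in> ring_span R S"
  shows "x + y \<in> ring_span R S"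
  using ring_span_diff[OF assms(1) ring_span_diff[OF ring_span_zero assms(2)]] by simp

lemma ring_span_scale:
  assumes "c \<in> R" "x \<in> ring_span R S"
  shows "c * x \<in> ring_span R S"
proof -
  obtain u where "x = (\<Sum>s\<in>S. u s * s)" "\<forall>s\<in>S. u s \<in> R"
    using assms by (auto simp: ring_span_def)
  then show ?thesis
    unfolding ring_span_def
    by (intro CollectI exI[of _ "\<lambda>s. c * u s"])
      (auto simp: sum_distrib_left mult.assoc intro: mult_mem assms(1))
qed

lemma ring_span_sum:
  "(\<And>i. i \<in> T \<Longrightarrow> f i \<in> ring_span R S) \<Longrightarrow> sum f T \<in> ring_span R S"
  by (induction T rule: infinite_finite_induct) (auto intro: ring_span_zero ring_span_add)

lemma ring_span_stable:
  assumes "\<And>s. s \<in> S \<Longrightarrow> x * s \<in> ring_span R S" "y \<in> ring_span R S"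
  shows "x * y \<in> ring_span R S"
proof -
  obtain u where u: "y = (\<Sum>s\<in>S. u s * s)" "\<forall>s\<in>S. u s \<in> R"
    using assms(2) by (auto simp: ring_span_def)
  have "x * y = (\<Sum>s\<in>S. u s * (x * s))"
    unfolding u by (simp add: sum_distrib_left mult.left_commute)
  then show ?thesis
    using u(2) assms(1) by (auto intro: ring_span_sum ring_span_scale)
qed

end

text \<open>The determinant trick: multiplication by \<open>x\<close> on the generators \<open>S\<close> is given by a matrix
  over \<open>R\<close>, which has \<open>x\<close> as an eigenvalue, so that \<open>x\<close> is a root of its characteristic
  polynomial. As \<open>1 \<in> S\<close>, the eigenvector, whose entries are the generators, is nonzero.\<close>
lemma integral_closureI_stable:
  fixes R :: "'a::field set"
  assumes R: "subring_set R" and fin: "finite S" and one: "1 \<in> S"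
    and stable: "\<And>s. s \<in> S \<Longrightarrow> x * s \<in> ring_span R S"
  shows "x \<in> integral_closure R"
proof -
  interpret subring_set R by fact
  obtain e where e: "bij_betw e {0..<card S} S"
    using ex_bij_betw_nat_finite[OF fin] by blast
  define N where "N = card S"
  have "\<forall>s\<in>S. \<exists>u. x * s = (\<Sum>t\<in>S. u t * t) \<and> (\<forall>t\<in>S. u t \<in> R)"
    using stable by (auto simp: ring_span_def)
  then obtain u where u: "\<And>s. s \<in> S \<Longrightarrow> x * s = (\<Sum>t\<in>S. u s t * t)"
    and uR: "\<And>s t. s \<in> S \<Longrightarrow> t \<in> S \<Longrightarrow> u s t \<in> R"
    by metis
  have eS: "e i \<in> S" if "i < N" for i
    using bij_betwE[OF e] that by (auto simp: N_def)
  define A where "A = mat N N (\<lambda>(i, j). u (e i) (e j))"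
  define v where "v = vec N e"
  have A: "A \<in> carrier_mat N N" by (simp add: A_def)
  have "A *\<^sub>v v = x \<cdot>\<^sub>v v"
  proof (rule eq_vecI)
    fix i assume "i < dim_vec (x \<cdot>\<^sub>v v)"
    then have i: "i < N" by (simp add: v_def)
    then have "(A *\<^sub>v v) $ i = (\<Sum>j\<in>{0..<N}. u (e i) (e j) * e j)"
      by (simp add: A_def v_def scalar_prod_def)
    also have "\<dots> = (\<Sum>t\<in>S. u (e i) t * t)"
      using sum.reindex_bij_betw[OF e, of "\<lambda>t. u (e i) t * t"] by (simp add: N_def)
    finally show "(A *\<^sub>v v) $ i = (x \<cdot>\<^sub>v v) $ i"
      using u[OF eS[OF i]] i by (simp add: v_def)
  qed (simp add: A_def v_def)
  moreover have "v \<noteq> 0\<^sub>v N"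
  proof
    assume v: "v = 0\<^sub>v N"
    obtain i where "i < N" "e i = 1"
      using e one by (metis N_def atLeastLessThan_iff bij_betw_imp_surj_on imageE)
    then have "v $ i = 1" by (simp add: v_def)
    with v \<open>i < N\<close> show False by simp
  qed
  ultimately have "eigenvalue A x"
    unfolding eigenvalue_def eigenvector_def by (intro exI[of _ v]) (simp add: A_def v_def)
  then have "poly (char_poly A) x = 0"
    using eigenvalue_root_char_poly[OF A] by simp
  moreover have "lead_coeff (char_poly A) = 1"
    using degree_monic_char_poly[OF A] by simp
  moreover have "set (coeffs (char_poly A)) \<subseteq> R"
    unfolding coeffs_subset_iff
    using coeff_char_poly_mem[OF A] uR eS by (simp add: A_def)
  ultimately show ?thesis
    unfolding integral_closure_def by blast
qed

text \<open>If \<open>\<alpha>\<close> is a root of a monic polynomial of degree \<open>m\<close> over \<open>R\<close>, then multiplication by \<open>\<alpha>\<close> keeps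
  \<open>y, \<alpha>y, \<dots>, \<alpha>\<^sup>m\<^sup>-\<^sup>1y\<close> in any span that contains them all: the equation of \<open>\<alpha>\<close> expresses \<open>\<alpha>\<^sup>my\<close> by
  them.\<close>
lemma (in subring_set) ring_span_power_step:
  fixes \<alpha> y :: 'a
  assumes p: "lead_coeff p = 1" "\<And>i. coeff p i \<in> R" "poly p \<alpha> = 0"
    and gen: "\<And>i. i < degree p \<Longrightarrow> \<alpha> ^ i * y \<in> ring_span R S" and i: "i < degree p"
  shows "\<alpha> * (\<alpha> ^ i * y) \<in> ring_span R S"
proof (cases "Suc i < degree p")
  case True
  then show ?thesis using gen[of "Suc i"] by (simp add: mult.assoc)
next
  case False
  then have deg: "Suc i = degree p" using i by simp
  have "0 = (\<Sum>j\<le>degree p. coeff p j * \<alpha> ^ j)"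
    using p(3) by (simp add: poly_altdef)
  also have "\<dots> = (\<Sum>j<degree p. coeff p j * \<alpha> ^ j) + \<alpha> ^ degree p"
    using p(1) by (simp flip: lessThan_Suc_atMost)
  finally have "\<alpha> ^ Suc i = 0 - (\<Sum>j<degree p. coeff p j * \<alpha> ^ j)"
    unfolding deg by (simp add: eq_neg_iff_add_eq_0 add.commute)
  then have "\<alpha> * (\<alpha> ^ i * y) = 0 - (\<Sum>j<degree p. coeff p j * (\<alpha> ^ j * y))"
    by (simp add: sum_distrib_right mult.assoc flip: mult.assoc[of \<alpha>])
  also have "\<dots> \<in> ring_span R S"
    by (intro ring_span_diff ring_span_zero ring_span_sum ring_span_scale p(2) gen) simp
  finally show ?thesis .
qed

lemma mem_integral_closure_base:
  assumes "subring_set R" "x \<in> R"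
  shows "x \<in> integral_closure R"
proof -
  interpret subring_set R by fact
  show ?thesis
    unfolding integral_closure_def
    using assms(2) one_mem uminus_mem by (auto intro!: exI[of _ "[:- x, 1:]"])
qed

lemma subring_set_integral_closure:
  fixes R :: "'a::field set"
  assumes R: "subring_set R"
  shows "subring_set (integral_closure R)"
proof -
  interpret subring_set R by fact
  have "\<alpha> - \<beta> \<in> integral_closure R \<and> \<alpha> * \<beta> \<in> integral_closure R"
    if mem: "\<alpha> \<in> integral_closure R" "\<beta> \<in> integral_closure R" for \<alpha> \<beta>
  proof -
    obtain p where p: "lead_coeff p = 1" "\<And>i. coeff p i \<in> R" "poly p \<alpha> = 0"
      using mem(1) by (auto simp: integral_closure_def coeffs_subset_iff)
    obtain q where q: "lead_coeff q = 1" "\<And>i. coeff q i \<in> R" "poly q \<beta> = 0"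
      using mem(2) by (auto simp: integral_closure_def coeffs_subset_iff)
    have pos: "degree p > 0" "degree q > 0"
      using p q by (auto simp: poly_altdef intro: gr0I)
    \<comment> \<open>The span of these monomials is stable under both \<open>\<alpha>\<close> and \<open>\<beta>\<close>, hence under \<open>\<alpha> - \<beta>\<close> and \<open>\<alpha>\<beta>\<close>.\<close>
    define S where "S = (\<lambda>(i, j). \<alpha> ^ i * \<beta> ^ j) ` ({..<degree p} \<times> {..<degree q})"
    have fin: "finite S" by (simp add: S_def)
    have one: "1 \<in> S"
      unfolding S_def using pos by (intro image_eqI[of _ _ "(0, 0)"]) auto
    have base: "\<alpha> ^ i * \<beta> ^ j \<in> ring_span R S" if "i < degree p" "j < degree q" for i j
      using that by (intro ring_span_base[OF fin]) (auto simp: S_def)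
    have \<alpha>S: "\<alpha> * s \<in> ring_span R S" if "s \<in> S" for s
      using that by (auto simp: S_def intro!: ring_span_power_step[OF p] base[unfolded S_def])
    have \<beta>S: "\<beta> * s \<in> ring_span R S" if s: "s \<in> S" for s
    proof -
      obtain i j where ij: "i < degree p" "j < degree q" "s = \<beta> ^ j * \<alpha> ^ i"
        using s unfolding S_def by (auto simp: mult.commute)
      then show ?thesis
        using base[of i] ring_span_power_step[OF q, of "\<alpha> ^ i" S j] by (simp add: mult.commute)
    qed
    have "(\<alpha> - \<beta>) * s \<in> ring_span R S" if "s \<in> S" for s
      unfolding left_diff_distrib using that by (intro ring_span_diff \<alpha>S \<beta>S)
    moreover have "\<alpha> * \<beta> * s \<in> ring_span R S" if "s \<in> S" for s
      unfolding mult.assoc by (rule ring_span_stable[OF \<alpha>S \<beta>S[OF that]])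
    ultimately show ?thesis
      by (intro conjI integral_closureI_stable[OF R fin one])
  qed
  then show ?thesis
    using mem_integral_closure_base[OF R one_mem] by unfold_locales auto
qed

lemma (in field_hom) image_integral_closure_subset:
  "hom ` integral_closure R \<subseteq> integral_closure (hom ` R)"
proof
  fix y assume "y \<in> hom ` integral_closure R"
  then obtain p x where p: "lead_coeff p = 1" "set (coeffs p) \<subseteq> R" "poly p x = 0" "y = hom x"
    by (auto simp: integral_closure_def)
  have deg: "degree (map_poly hom p) = degree p"
    by (rule degree_map_poly) auto
  have "poly (map_poly hom p) y = hom (poly p x)"
    by (simp add: poly_altdef deg coeff_map_poly p(4) hom_distribs)
  moreover have "lead_coeff (map_poly hom p) = 1"
    using p(1) by (simp add: deg coeff_map_poly)
  moreover have "set (coeffs (map_poly hom p)) \<subseteq> hom ` R"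
    using p(2) by (simp add: coeffs_map_poly image_mono)
  ultimately show "y \<in> integral_closure (hom ` R)"
    using p(3) unfolding integral_closure_def mem_Collect_eq
    by (intro exI[of _ "map_poly hom p"]) simp
qed

lemma subring_set_infinite_valuation_ring:
  "subring_set (infinite_valuation_ring :: 'k::field poly fract set)"
proof
  show "1 \<in> (infinite_valuation_ring :: 'k poly fract set)"
    unfolding infinite_valuation_ring_def
    by (intro CollectI exI[of _ 1]) (simp add: One_fract_def)
next
  fix x y :: "'k poly fract"
  assume "x \<in> infinite_valuation_ring" "y \<in> infinite_valuation_ring"
  then obtain p q p' q' where
    x: "x = Fract p q" "q \<noteq> 0" "degree p \<le> degree q" and
    y: "y = Fract p' q'" "q' \<noteq> 0" "degree p' \<le> degree q'"
    by (auto simp: infinite_valuation_ring_def)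
  have deg: "degree (q * q') = degree q + degree q'"
    using x y by (simp add: degree_mult_eq)
  have "degree (p * q') \<le> degree (q * q')" "degree (p' * q) \<le> degree (q * q')"
    "degree (p * p') \<le> degree (q * q')"
    unfolding deg using x(3) y(3) degree_mult_le[of p q'] degree_mult_le[of p' q]
      degree_mult_le[of p p'] by linarith+
  then have "degree (p * q' - p' * q) \<le> degree (q * q')" "degree (p * p') \<le> degree (q * q')"
    by (auto intro: degree_diff_le)
  moreover have "x - y = Fract (p * q' - p' * q) (q * q')" "x * y = Fract (p * p') (q * q')"
    "q * q' \<noteq> 0"
    using x y by simp_all
  ultimately show "x - y \<in> infinite_valuation_ring" "x * y \<in> infinite_valuation_ring"
    unfolding infinite_valuation_ring_def by blast+
qed

lemma subring_set_ring_inf: "field_hom \<phi> \<Longrightarrow> subring_set (ring_inf \<phi>)"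
  unfolding ring_inf_def
  by (intro subring_set_integral_closure field_hom.subring_set_image
      subring_set_infinite_valuation_ring)

lemma image_ring_inf_subset: "field_hom \<psi> \<Longrightarrow> \<psi> ` ring_inf \<phi> \<subseteq> ring_inf (\<psi> \<circ> \<phi>)"
  unfolding ring_inf_def
  using field_hom.image_integral_closure_subset[of \<psi> "\<phi> ` infinite_valuation_ring"]
  by (simp add: image_comp)


section \<open>Conorm\<close>

lemma mult_mat_vec_index_sum:
  assumes "g \<in> carrier_mat k m" "y \<in> carrier_vec m" "l < k"
  shows "(g *\<^sub>v y) $ l = (\<Sum>i<m. g $$ (l, i) * y $ i)"
  using assms by (auto simp: scalar_prod_def atLeast0LessThan intro!: sum.cong)

text \<open>The definition takes sums over initial segments of the natural numbers; here any finite index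
  set is admitted, as for the sums over pairs below.\<close>
lemma extend_latticeI:
  fixes \<psi> :: "'a::field \<Rightarrow> 'b::field" and s :: "'t \<Rightarrow> 'a vec"
  assumes "finite T" "\<And>t. t \<in> T \<Longrightarrow> a t \<in> A'" "\<And>t. t \<in> T \<Longrightarrow> s t \<in> L"
  shows "vec r (\<lambda>l. \<Sum>t\<in>T. a t * \<psi> (s t $ l)) \<in> extend_lattice \<psi> A' r L"
proof -
  obtain e where e: "bij_betw e {..<card T} T"
    using ex_bij_betw_nat_finite[OF assms(1)] by (auto simp: atLeast0LessThan)
  have "(\<Sum>t\<in>T. a t * \<psi> (s t $ l)) = (\<Sum>j<card T. a (e j) * \<psi> (s (e j) $ l))" for l
    using sum.reindex_bij_betw[OF e, of "\<lambda>t. a t * \<psi> (s t $ l)"] by simp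
  then show ?thesis
    unfolding extend_lattice_def
    using assms(2,3) bij_betwE[OF e]
    by (auto intro!: exI[of _ "card T"] exI[of _ "\<lambda>j. a (e j)"] exI[of _ "\<lambda>j. s (e j)"])
qed

text \<open>That each ideal contains zero is needed to split a coefficient vector into vectors with a
  single nonzero entry. No property of \<open>A'\<close> is used.\<close>
lemma (in field_hom) extend_lattice_ideal_sum:
  assumes g: "g \<in> carrier_mat r r" and len: "length I = r" and zero: "\<And>i. i < r \<Longrightarrow> 0 \<in> I ! i"
  shows "extend_lattice hom A' r (ideal_sum I g) =
    ideal_sum (map (extend_ideal hom A') I) (map_mat hom g)"
proof (intro equalityI subsetI)
  fix x assume "x \<in> extend_lattice hom A' r (ideal_sum I g)"
  then obtain m :: nat and a s where
    x: "x = vec r (\<lambda>l. \<Sum>j<m. a j * hom (s j $ l))" and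
    as: "\<And>j. j < m \<Longrightarrow> a j \<in> A'" "\<And>j. j < m \<Longrightarrow> s j \<in> ideal_sum I g"
    by (auto simp: extend_lattice_def)
  have "\<forall>j. \<exists>y. j < m \<longrightarrow> s j = g *\<^sub>v y \<and> y \<in> carrier_vec r \<and> (\<forall>i<r. y $ i \<in> I ! i)"
    using as(2) by (force simp: ideal_sum_def len)
  then obtain y where y: "\<And>j. j < m \<Longrightarrow> s j = g *\<^sub>v y j" "\<And>j. j < m \<Longrightarrow> y j \<in> carrier_vec r"
    "\<And>j i. j < m \<Longrightarrow> i < r \<Longrightarrow> y j $ i \<in> I ! i"
    by metis
  define Y where "Y = vec r (\<lambda>i. \<Sum>j<m. a j * hom (y j $ i))"
  have "x = map_mat hom g *\<^sub>v Y"
  proof (rule eq_vecI)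
    fix l assume "l < dim_vec (map_mat hom g *\<^sub>v Y)"
    then have l: "l < r" using g by simp
    have "(map_mat hom g *\<^sub>v Y) $ l = (\<Sum>i<r. hom (g $$ (l, i)) * (\<Sum>j<m. a j * hom (y j $ i)))"
      using g l by (subst mult_mat_vec_index_sum[where k = r and m = r]) (auto simp: Y_def)
    also have "\<dots> = (\<Sum>j<m. a j * hom (\<Sum>i<r. g $$ (l, i) * y j $ i))"
      unfolding sum_distrib_left hom_sum hom_mult
      by (subst sum.swap) (simp add: mult.left_commute)
    also have "\<dots> = (\<Sum>j<m. a j * hom (s j $ l))"
      using mult_mat_vec_index_sum[OF g y(2) l] y(1) by (intro sum.cong) auto
    finally show "x $ l = (map_mat hom g *\<^sub>v Y) $ l" using l by (simp add: x)
  qed (use g in \<open>simp add: x\<close>)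
  moreover have "Y $ i \<in> extend_ideal hom A' (I ! i)" if "i < r" for i
    using that as(1) y(3) by (auto simp: Y_def extend_ideal_def intro!: exI[of _ m] exI[of _ a])
  ultimately show "x \<in> ideal_sum (map (extend_ideal hom A') I) (map_mat hom g)"
    unfolding ideal_sum_def by (auto simp: len Y_def)
next
  fix x assume "x \<in> ideal_sum (map (extend_ideal hom A') I) (map_mat hom g)"
  then obtain Y where x: "x = map_mat hom g *\<^sub>v Y" and Y: "Y \<in> carrier_vec r"
    "\<And>i. i < r \<Longrightarrow> Y $ i \<in> extend_ideal hom A' (I ! i)"
    by (auto simp: ideal_sum_def len)
  have ex: "\<forall>i. \<exists>(m::nat) a s. i < r \<longrightarrow>
      Y $ i = (\<Sum>j<m. a j * hom (s j)) \<and> (\<forall>j<m. a j \<in> A' \<and> s j \<in> I ! i)"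
    using Y(2) by (fastforce simp: extend_ideal_def)
  from choice[OF ex] obtain m :: "nat \<Rightarrow> nat" where ex: "\<forall>i. \<exists>a s. i < r \<longrightarrow>
      Y $ i = (\<Sum>j<m i. a j * hom (s j)) \<and> (\<forall>j<m i. a j \<in> A' \<and> s j \<in> I ! i)" ..
  from choice[OF ex] obtain a where ex: "\<forall>i. \<exists>s. i < r \<longrightarrow>
      Y $ i = (\<Sum>j<m i. a i j * hom (s j)) \<and> (\<forall>j<m i. a i j \<in> A' \<and> s j \<in> I ! i)" ..
  from choice[OF ex] obtain s where
    as: "\<And>i. i < r \<Longrightarrow> Y $ i = (\<Sum>j<m i. a i j * hom (s i j))"
    "\<And>i j. i < r \<Longrightarrow> j < m i \<Longrightarrow> a i j \<in> A'" "\<And>i j. i < r \<Longrightarrow> j < m i \<Longrightarrow> s i j \<in> I ! i"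
    by blast
  \<comment> \<open>\<open>w (i, j)\<close> is the multiple of the \<open>i\<close>-th column by \<open>s i j\<close>, an element of the given sum.\<close>
  define T where "T = Sigma {..<r} (\<lambda>i. {..<m i})"
  define w where "w = (\<lambda>(i, j). g *\<^sub>v vec r (\<lambda>k. if k = i then s i j else 0))"
  have w: "w (i, j) $ l = g $$ (l, i) * s i j" if "i < r" "l < r" for i j l
    unfolding w_def prod.case using that
    by (subst mult_mat_vec_index_sum[OF g])
      (auto simp: if_distrib[of "\<lambda>x. _ * x"] cong: if_cong)
  have "x = vec r (\<lambda>l. \<Sum>t\<in>T. (case t of (i, j) \<Rightarrow> a i j) * hom (w t $ l))"
  proof (rule eq_vecI)
    fix l assume "l < dim_vec (vec r (\<lambda>l. \<Sum>t\<in>T. (case t of (i, j) \<Rightarrow> a i j) * hom (w t $ l)))"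
    then have l: "l < r" by simp
    have "x $ l = (\<Sum>i<r. hom (g $$ (l, i)) * (\<Sum>j<m i. a i j * hom (s i j)))"
      unfolding x using g l Y(1) as(1)
      by (subst mult_mat_vec_index_sum[where k = r and m = r]) auto
    also have "\<dots> = (\<Sum>i<r. \<Sum>j<m i. a i j * hom (w (i, j) $ l))"
      using l by (intro sum.cong) (auto simp: w hom_mult sum_distrib_left mult.left_commute)
    also have "\<dots> = (\<Sum>t\<in>T. (case t of (i, j) \<Rightarrow> a i j) * hom (w t $ l))"
      unfolding T_def by (subst sum.Sigma) (auto intro!: sum.cong)
    finally show "x $ l = vec r (\<lambda>l. \<Sum>t\<in>T. (case t of (i, j) \<Rightarrow> a i j) * hom (w t $ l)) $ l"
      using l by simp
  qed (use g in \<open>simp add: x\<close>)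
  also have "\<dots> \<in> extend_lattice hom A' r (ideal_sum I g)"
    using as(2,3) zero
    by (intro extend_latticeI) (auto simp: T_def w_def ideal_sum_def len)
  finally show "x \<in> extend_lattice hom A' r (ideal_sum I g)" .
qed

lemma extend_ideal_subring:
  assumes "subring_set A'" and one: "1 \<in> A" and sub: "\<psi> ` A \<subseteq> A'" and "\<psi> 1 = 1"
  shows "extend_ideal \<psi> A' A = A'"
proof -
  interpret subring_set A' by fact
  show ?thesis
  proof (intro equalityI subsetI)
    fix x assume "x \<in> extend_ideal \<psi> A' A"
    then show "x \<in> A'"
      using sub by (auto simp: extend_ideal_def intro!: sum_mem mult_mem)
  next
    fix x assume "x \<in> A'"
    then show "x \<in> extend_ideal \<psi> A' A"
      using one \<open>\<psi> 1 = 1\<close> unfolding extend_ideal_def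
      by (intro CollectI exI[of _ "1::nat"] exI[of _ "\<lambda>_. x"] exI[of _ "\<lambda>_. 1"]) auto
  qed
qed


section \<open>Restriction\<close>

text \<open>In the lexicographic order of pairs, position \<open>k\<close> holds the pair of quotient and remainder of
  \<open>k\<close> by \<open>n\<close>.\<close>
lemma concat_map_upt_eq_div_mod:
  "[f i j. i \<leftarrow> [0..<r], j \<leftarrow> [0..<n]] = map (\<lambda>k. f (k div n) (k mod n)) [0..<r * n]"
proof (induction r)
  case (Suc r)
  have "[0..<Suc r * n] = [0..<r * n] @ map (\<lambda>j. r * n + j) [0..<n]"
    by (intro nth_equalityI) (auto simp: nth_append)
  with Suc show ?case
    by (auto simp: comp_def)
qed simp

lemma sum_lessThan_mult: "(\<Sum>k<r * n. f k) = (\<Sum>i<r. \<Sum>j<n. f (i * n + j))" for r n :: nat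
proof -
  have "(\<Sum>j<n. f (i * n + j)) = sum f {i * n..<i * n + n}" for i
    using sum.shift_bounds_nat_ivl[of f 0 "i * n" n] by (simp add: atLeast0LessThan add.commute)
  then show ?thesis by (simp add: sum.nat_group)
qed

text \<open>The columns of the restricted matrix are the coordinate vectors of the \<open>a\<^sub>i\<^sub>jx\<^sub>i\<close>, so that it maps
  coefficients over the lower field to the coordinates of the corresponding combination. The
  elements \<open>a i j\<close> are arbitrary here.\<close>
lemma restrict_vec_mult_mat_vec:
  fixes \<psi> :: "'a::field \<Rightarrow> 'b::field"
  assumes c: "field_basis \<psi> c" "length c = n" and g: "g \<in> carrier_mat r r"
  shows "restrict_vec \<psi> c (g *\<^sub>v vec r (\<lambda>i. \<Sum>j<n. \<psi> (z (i * n + j)) * a i j)) =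
    Rest_matrix \<psi> c r a g *\<^sub>v vec (r * n) z"
proof -
  interpret finite_dimensional_vector_space "scale_by \<psi>" "set c"
    using c(1) by (simp add: field_basis_def)
  note rep_sum = representation_sum[OF independent_Basis, of _ _, unfolded span_Basis, simplified]
  note rep_scale = representation_scale[OF independent_Basis, unfolded span_Basis, simplified]
  have M: "Rest_matrix \<psi> c r a g = mat_of_cols (r * n)
      (map (\<lambda>k. restrict_vec \<psi> c (a (k div n) (k mod n) \<cdot>\<^sub>v col g (k div n))) [0..<r * n])"
    unfolding Rest_matrix_def c(2) concat_map_upt_eq_div_mod ..
  have carr: "Rest_matrix \<psi> c r a g \<in> carrier_mat (r * n) (r * n)"
    unfolding M by (simp add: mat_of_cols_def)
  show ?thesis
  proof (rule eq_vecI)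
    fix p assume "p < dim_vec (Rest_matrix \<psi> c r a g *\<^sub>v vec (r * n) z)"
    then have p: "p < r * n" using carr by simp
    then have "n > 0" by (cases n) auto
    define l where "l = p div n"
    define b where "b = c ! (p mod n)"
    have l: "l < r" using p by (simp add: l_def less_mult_imp_div_less)
    have entry: "Rest_matrix \<psi> c r a g $$ (p, i * n + j) =
        representation (set c) (a i j * g $$ (l, i)) b" if "i < r" "j < n" for i j
    proof -
      have "i * n + j < r * n"
        using that by (metis add_less_cancel_left less_le_trans mult_Suc add.commute
            mult_le_mono1 Suc_leI)
      then show ?thesis
        using that p l g \<open>n > 0\<close>
        by (simp add: M mat_of_cols_index restrict_vec_def c(2) l_def b_def)
    qed
    have "restrict_vec \<psi> c (g *\<^sub>v vec r (\<lambda>i. \<Sum>j<n. \<psi> (z (i * n + j)) * a i j)) $ p =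
        representation (set c) (\<Sum>i<r. g $$ (l, i) * (\<Sum>j<n. \<psi> (z (i * n + j)) * a i j)) b"
      using p g l mult_mat_vec_index_sum[OF g _ l]
      by (simp add: restrict_vec_def c(2) b_def flip: l_def)
    also have "(\<Sum>i<r. g $$ (l, i) * (\<Sum>j<n. \<psi> (z (i * n + j)) * a i j)) =
        (\<Sum>i<r. \<Sum>j<n. \<psi> (z (i * n + j)) * (a i j * g $$ (l, i)))"
      by (simp add: sum_distrib_left mult_ac)
    also have "representation (set c) \<dots> b =
        (\<Sum>i<r. \<Sum>j<n. z (i * n + j) * representation (set c) (a i j * g $$ (l, i)) b)"
      by (simp add: rep_sum rep_scale)
    also have "\<dots> = (\<Sum>k<r * n. Rest_matrix \<psi> c r a g $$ (p, k) * z k)"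
      unfolding sum_lessThan_mult by (intro sum.cong) (auto simp: entry mult.commute)
    also have "\<dots> = (Rest_matrix \<psi> c r a g *\<^sub>v vec (r * n) z) $ p"
      using mult_mat_vec_index_sum[OF carr _ p, of "vec (r * n) z"] by simp
    finally show "restrict_vec \<psi> c (g *\<^sub>v vec r (\<lambda>i. \<Sum>j<n. \<psi> (z (i * n + j)) * a i j)) $ p =
        (Rest_matrix \<psi> c r a g *\<^sub>v vec (r * n) z) $ p" .
  qed (use g carr in \<open>simp add: restrict_vec_def c(2)\<close>)
qed

text \<open>Of a pseudo-basis, or of a module basis, only the generating property is used.\<close>
lemma restrict_vec_ideal_sum:
  fixes \<psi> :: "'a::field \<Rightarrow> 'b::field"
  assumes c: "field_basis \<psi> c" "length c = n" and g: "g \<in> carrier_mat r r" and len: "length I = r"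
    and I: "\<And>i. i < r \<Longrightarrow> (\<lambda>y. \<Sum>j<n. \<psi> (y j) * a i j) ` (\<Pi>\<^sub>E j\<in>{..<n}. b i j) = I ! i"
  shows "restrict_vec \<psi> c ` ideal_sum I g =
    ideal_sum (Rest_ideals r n b) (Rest_matrix \<psi> c r a g)"
proof -
  note key = restrict_vec_mult_mat_vec[OF c g, of _ a]
  have ideals: "Rest_ideals r n b = map (\<lambda>k. b (k div n) (k mod n)) [0..<r * n]"
    unfolding Rest_ideals_def by (rule concat_map_upt_eq_div_mod)
  show ?thesis
  proof (intro equalityI subsetI)
    fix x assume "x \<in> restrict_vec \<psi> c ` ideal_sum I g"
    then obtain Y where x: "x = restrict_vec \<psi> c (g *\<^sub>v Y)" and
      Y: "Y \<in> carrier_vec r" "\<And>i. i < r \<Longrightarrow> Y $ i \<in> I ! i"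
      by (auto simp: ideal_sum_def len)
    have "\<forall>i. \<exists>y. i < r \<longrightarrow> Y $ i = (\<Sum>j<n. \<psi> (y j) * a i j) \<and> y \<in> (\<Pi>\<^sub>E j\<in>{..<n}. b i j)"
      using Y(2) I by blast
    then obtain y where y: "\<And>i. i < r \<Longrightarrow> Y $ i = (\<Sum>j<n. \<psi> (y i j) * a i j)"
      "\<And>i. i < r \<Longrightarrow> y i \<in> (\<Pi>\<^sub>E j\<in>{..<n}. b i j)"
      by metis
    define z where "z = (\<lambda>k. y (k div n) (k mod n))"
    have "Y = vec r (\<lambda>i. \<Sum>j<n. \<psi> (z (i * n + j)) * a i j)"
      using Y(1) y(1) by (intro eq_vecI) (auto simp: z_def intro!: sum.cong)
    then have "x = Rest_matrix \<psi> c r a g *\<^sub>v vec (r * n) z"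
      using x key by simp
    moreover have "z k \<in> b (k div n) (k mod n)" if "k < r * n" for k
    proof -
      have "n > 0" using that by (cases n) auto
      then show ?thesis
        using PiE_mem[OF y(2)[of "k div n"], of "k mod n"] that
        by (simp add: z_def less_mult_imp_div_less)
    qed
    ultimately show "x \<in> ideal_sum (Rest_ideals r n b) (Rest_matrix \<psi> c r a g)"
      unfolding ideal_sum_def ideals mem_Collect_eq
      by (intro exI[of _ "vec (r * n) z"]) simp
  next
    fix x assume "x \<in> ideal_sum (Rest_ideals r n b) (Rest_matrix \<psi> c r a g)"
    then obtain Z where x: "x = Rest_matrix \<psi> c r a g *\<^sub>v Z" and
      Z: "Z \<in> carrier_vec (r * n)" "\<And>k. k < r * n \<Longrightarrow> Z $ k \<in> b (k div n) (k mod n)"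
      by (auto simp: ideal_sum_def ideals)
    define Y where "Y = vec r (\<lambda>i. \<Sum>j<n. \<psi> (Z $ (i * n + j)) * a i j)"
    have "Z = vec (r * n) (\<lambda>k. Z $ k)" using Z(1) by auto
    then have "x = restrict_vec \<psi> c (g *\<^sub>v Y)"
      unfolding x Y_def key by simp
    moreover have "Y $ i \<in> I ! i" if i: "i < r" for i
    proof -
      define y where "y = restrict (\<lambda>j. Z $ (i * n + j)) {..<n}"
      have "y \<in> (\<Pi>\<^sub>E j\<in>{..<n}. b i j)"
        unfolding y_def
      proof (intro restrict_PiE_iff[THEN iffD2] ballI)
        fix j assume "j \<in> {..<n}"
        then have j: "j < n" by simp
        have "i * n + j < r * n"
          using i j by (metis add_less_cancel_left less_le_trans mult_Suc add.commute
              mult_le_mono1 Suc_leI)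
        from Z(2)[OF this] j show "Z $ (i * n + j) \<in> b i j" by simp
      qed
      moreover have "Y $ i = (\<Sum>j<n. \<psi> (y j) * a i j)"
        using i by (auto simp: Y_def y_def)
      ultimately show ?thesis using I[OF i] by blast
    qed
    ultimately show "x \<in> restrict_vec \<psi> c ` ideal_sum I g"
      unfolding ideal_sum_def len by (intro image_eqI[of _ _ "g *\<^sub>v Y"]) (auto simp: Y_def)
  qed
qed

text \<open>Constant ideals account for the infinite component, which has trivial coefficient ideals.\<close>
lemma Rest_ideals_const: "Rest_ideals r n (\<lambda>_ _. A) = replicate (r * n) A"
  unfolding Rest_ideals_def concat_map_upt_eq_div_mod by (simp add: map_replicate_const)


section \<open>Compatibility of lattice pairs with conorm and restriction\<close>

theorem theorem4p2p4:
  fixes \<phi> :: "'k::field poly fract \<Rightarrow> 'a::field"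
    and \<psi> :: "'a \<Rightarrow> 'b::field"
    and c :: "'b list"
    and n :: nat
  assumes "perfect_field TYPE('k)"
    and "finite_separable \<phi>"
    and "finite_separable \<psi>"
    and "field_basis \<psi> c"
    and "length c = n"
  shows
    "(\<forall>r g. is_matrix_pair (ring_fi \<phi>) r g \<longrightarrow>
        CoN_lattice_pair \<psi> (ring_fi (\<psi> \<circ> \<phi>)) (ring_inf (\<psi> \<circ> \<phi>)) r (LP (ring_inf \<phi>) g) =
        LP (ring_inf (\<psi> \<circ> \<phi>)) (CoN_matrix_pair \<psi> (ring_fi (\<psi> \<circ> \<phi>)) g))
     \<and>
     (\<forall>r g' b a d.
        is_matrix_pair (ring_fi (\<psi> \<circ> \<phi>)) r g' \<longrightarrow>
        (\<forall>i<r. is_pseudo_basis \<psi> (ring_fi \<phi>) n (fst g' ! i) (b i) (a i)) \<longrightarrow>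
        (\<forall>i<r. is_module_basis \<psi> (ring_inf \<phi>) n (ring_inf (\<psi> \<circ> \<phi>)) (d i)) \<longrightarrow>
        Rest_lattice_pair \<psi> c (LP (ring_inf (\<psi> \<circ> \<phi>)) g') =
        LP (ring_inf \<phi>) (Rest_matrix_pair \<psi> c b a d g'))"
proof -
  have \<phi>: "field_hom \<phi>" and \<psi>: "field_hom \<psi>"
    using assms(2,3) by (simp_all add: finite_separable_def)
  interpret \<phi>: field_hom \<phi> by fact
  interpret \<psi>: field_hom \<psi> by fact
  have \<psi>\<phi>: "field_hom (\<psi> \<circ> \<phi>)"
    by unfold_locales (simp_all add: \<phi>.hom_add \<psi>.hom_add \<phi>.hom_mult \<psi>.hom_mult)
  have one: "1 \<in> ring_inf \<phi>" and zero: "0 \<in> ring_inf \<phi>"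
    using subring_set_ring_inf[OF \<phi>] subring_set.one_mem subring_set.zero_mem by blast+
  have ext: "extend_ideal \<psi> (ring_inf (\<psi> \<circ> \<phi>)) (ring_inf \<phi>) = ring_inf (\<psi> \<circ> \<phi>)"
    by (intro extend_ideal_subring subring_set_ring_inf \<psi>\<phi> one image_ring_inf_subset \<psi> \<psi>.hom_one)
  show ?thesis
  proof (intro conjI allI impI)
    fix r :: nat and g :: "'a matrix_pair"
    assume g: "is_matrix_pair (ring_fi \<phi>) r g"
    obtain I g_fi g_inf where "g = (I, g_fi, g_inf)" by (cases g)
    with g show "CoN_lattice_pair \<psi> (ring_fi (\<psi> \<circ> \<phi>)) (ring_inf (\<psi> \<circ> \<phi>)) r (LP (ring_inf \<phi>) g) =
        LP (ring_inf (\<psi> \<circ> \<phi>)) (CoN_matrix_pair \<psi> (ring_fi (\<psi> \<circ> \<phi>)) g)"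
      by (simp add: CoN_lattice_pair_def LP_def CoN_matrix_pair_def is_matrix_pair_def GL_def
          fractional_ideal_def \<psi>.extend_lattice_ideal_sum zero ext)
  next
    fix r :: nat and g' :: "'b matrix_pair" and b a d
    assume g': "is_matrix_pair (ring_fi (\<psi> \<circ> \<phi>)) r g'"
      and a: "\<forall>i<r. is_pseudo_basis \<psi> (ring_fi \<phi>) n (fst g' ! i) (b i) (a i)"
      and d: "\<forall>i<r. is_module_basis \<psi> (ring_inf \<phi>) n (ring_inf (\<psi> \<circ> \<phi>)) (d i)"
    obtain I g_fi g_inf where g'_eq: "g' = (I, g_fi, g_inf)" by (cases g')
    then have len: "length I = r" and carr: "g_fi \<in> carrier_mat r r" "g_inf \<in> carrier_mat r r"
      using g' by (simp_all add: is_matrix_pair_def GL_def)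
    have "restrict_vec \<psi> c ` ideal_sum I g_fi =
        ideal_sum (Rest_ideals r n b) (Rest_matrix \<psi> c r a g_fi)"
      using a by (intro restrict_vec_ideal_sum assms carr len)
        (simp add: g'_eq is_pseudo_basis_def bij_betw_def)
    moreover have "restrict_vec \<psi> c ` ideal_sum (replicate r (ring_inf (\<psi> \<circ> \<phi>))) g_inf =
        ideal_sum (Rest_ideals r n (\<lambda>_ _. ring_inf \<phi>)) (Rest_matrix \<psi> c r d g_inf)"
      using d by (intro restrict_vec_ideal_sum assms carr)
        (simp_all add: is_module_basis_def bij_betw_def)
    moreover have "length (Rest_ideals r n b) = r * n"
      by (simp add: Rest_ideals_def concat_map_upt_eq_div_mod)
    ultimately show "Rest_lattice_pair \<psi> c (LP (ring_inf (\<psi> \<circ> \<phi>)) g') =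
        LP (ring_inf \<phi>) (Rest_matrix_pair \<psi> c b a d g')"
      by (simp add: g'_eq Rest_lattice_pair_def LP_def Rest_matrix_pair_def len assms
          Rest_ideals_const)
  qed
qed

end
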